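(* Let $m,n$ be positive integers and suppose that $\mathcal{A}\in T_{m,n}$ is a strong $P$ tensor. Then $\mathrm{TCP}(q,\mathcal{A})$ has the GUS-property, i.e., for every $q\in\mathbb{R}^n$ the problem $\mathrm{TCP}(q,\mathcal{A})$ has a unique solution.
   Context: Write $[n]=\{1,\dots,n\}$. $T_{m,n}$ denotes the set of all real $m$th order $n$-dimensional tensors $\mathcal{A}=(a_{i_1i_2\cdots i_m})$, $i_1,\dots,i_m\in[n]$ (no symmetry assumed). For $x\in\mathbb{R}^n$, $\mathcal{A}x^{m-1}\in\mathbb{R}^n$ is defined by $(\mathcal{A}x^{m-1})_i=\sum_{i_2,\dots,i_m=1}^n a_{ii_2\cdots i_m}x_{i_2}\cdots x_{i_m}$ for $i\in[n]$. For $q\in\mathbb{R}^n$, $\mathrm{TCP}(q,\mathcal{A})$ is the problem of finding $x\in\mathbb{R}^n$ such that $x\ge 0$, $\mathcal{A}x^{m-1}+q\ge 0$ and $x^T(\mathcal{A}x^{m-1}+q)=0$ (inequalities componentwise). A mapping $F:K\subseteq\mathbb{R}^n\to\mathbb{R}^n$ is a $P$-function if $\max_{i\in[n]}(x_i-y_i)(F_i(x)-F_i(y))>0$ for all pairs of distinct vectors $x,y\in K$. A tensor $\mathcal{A}\in T_{m,n}$ is a strong $P$ tensor iff $F(x)=\mathcal{A}x^{m-1}+q$ is a $P$-function on $\mathbb{R}^n$ (this condition does not depend on the choice of $q\in\mathbb{R}^n$). *)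

theory Defs
  imports "HOL-Analysis.Analysis"
begin

text \<open>
  A real tensor of order m and dimension n = CARD('n) is a family of reals indexed by the
  index tuples (i_1, ..., i_m), given here as lists over 'n. Only the entries at lists of length m
  belong to the tensor; for m \<open>\<ge>\<close> 1 the notions below read no other entry.
\<close>

type_synonym 'n tensor = "'n list \<Rightarrow> real"

definition tensor_apply :: "nat \<Rightarrow> 'n::finite tensor \<Rightarrow> real ^ 'n \<Rightarrow> real ^ 'n" where
  "tensor_apply m A x =
     (\<chi> i. \<Sum>js | length js = m - 1. A (i # js) * (\<Prod>j\<leftarrow>js. x $ j))"

definition TCP_solution :: "nat \<Rightarrow> real ^ 'n \<Rightarrow> 'n::finite tensor \<Rightarrow> real ^ 'n \<Rightarrow> bool" where
  "TCP_solution m q A x \<longleftrightarrow>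
     (\<forall>i. 0 \<le> x $ i) \<and>
     (\<forall>i. 0 \<le> (tensor_apply m A x + q) $ i) \<and>
     x \<bullet> (tensor_apply m A x + q) = 0"

definition GUS_property :: "nat \<Rightarrow> 'n::finite tensor \<Rightarrow> bool" where
  "GUS_property m A \<longleftrightarrow> (\<forall>q. \<exists>!x. TCP_solution m q A x)"

definition P_function_on :: "(real ^ 'n::finite) set \<Rightarrow> (real ^ 'n \<Rightarrow> real ^ 'n) \<Rightarrow> bool" where
  "P_function_on K F \<longleftrightarrow>
     (\<forall>x\<in>K. \<forall>y\<in>K. x \<noteq> y \<longrightarrow> Max (range (\<lambda>i. (x $ i - y $ i) * (F x $ i - F y $ i))) > 0)"

definition strong_P_tensor :: "nat \<Rightarrow> 'n::finite tensor \<Rightarrow> bool" where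
  "strong_P_tensor m A \<longleftrightarrow> (\<forall>q. P_function_on UNIV (\<lambda>x. tensor_apply m A x + q))"

text \<open>The universal quantifier over q is harmless: any single q gives the same condition.\<close>

lemma strong_P_tensor_iff:
  "strong_P_tensor m A \<longleftrightarrow> P_function_on UNIV (\<lambda>x. tensor_apply m A x + q)"
  by (simp add: strong_P_tensor_def P_function_on_def)

text \<open>
  The sum in \<open>tensor_apply\<close> ranges over a finite set, so it is not the default value 0.
\<close>

lemma finite_index_lists: "finite {js :: 'n::finite list. length js = k}"
  using finite_lists_length_eq[of "UNIV :: 'n set" k] by simp

end

theory Submission
  imports Defs
begin

text \<open>
  Uniqueness is the usual argument for \<open>P\<close>-functions: if \<open>x\<close> and \<open>y\<close> both solve the
  complementarity problem of \<open>G\<close>, then \<open>(x\<^sub>i - y\<^sub>i) (G\<^sub>i x - G\<^sub>i y) = - x\<^sub>i G\<^sub>i y - y\<^sub>i G\<^sub>i x \<le> 0\<close> for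
  every \<open>i\<close>, so \<open>x = y\<close> (lemma \<open>P_function_complementarity_unique\<close>).

  For existence, put \<open>F x = A x\<^sup>m\<^sup>-\<^sup>1\<close>. On a box \<open>[0,r]\<^sup>n\<close>, Brouwer's theorem for the map
  \<open>x \<mapsto> clamp (x - F x - q)\<close> solves the problem up to a defect on the outer faces: where
  \<open>x\<^sub>i = r\<close>, only \<open>F\<^sub>i x + q\<^sub>i \<le> 0\<close> is known (lemma \<open>box_complementarity\<close>). In every coordinate
  this still gives \<open>x\<^sub>i (F\<^sub>i x + q\<^sub>i) \<le> 0\<close>. The \<open>P\<close> property compared with the origin says that
  some \<open>x\<^sub>i F\<^sub>i x\<close> is positive for \<open>x \<noteq> 0\<close>; by compactness of the sphere and homogeneity of \<open>F\<close>
  the sum of the positive parts grows at least like \<open>\<parallel>x\<parallel>\<^sup>m\<close>, while \<open>x\<^sub>i q\<^sub>i\<close> grows only like \<open>\<parallel>x\<parallel>\<close>. For \<open>m \<ge> 2\<close> the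
  points with \<open>x\<^sub>i (F\<^sub>i x + q\<^sub>i) \<le> 0\<close> for all \<open>i\<close> therefore lie in a ball of a radius that depends
  only on \<open>F\<close> and \<open>q\<close> (lemma \<open>homogeneous_a_priori_bound\<close>); with \<open>r\<close> equal to that radius, the
  fixed point misses the outer faces and is a solution. A tensor of order 1 is never strong \<open>P\<close>,
  because \<open>F\<close> is then constant.
\<close>

section \<open>P-functions and uniqueness\<close>

lemma P_function_onD:
  assumes "P_function_on K F" "x \<in> K" "y \<in> K" "x \<noteq> y"
  obtains i where "(x $ i - y $ i) * (F x $ i - F y $ i) > 0"
proof -
  let ?R = "range (\<lambda>i. (x $ i - y $ i) * (F x $ i - F y $ i))"
  have "Max ?R > 0" using assms unfolding P_function_on_def by blast
  moreover have "Max ?R \<in> ?R" by (rule Max_in) auto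
  ultimately obtain i where "Max ?R = (x $ i - y $ i) * (F x $ i - F y $ i)" by blast
  with \<open>Max ?R > 0\<close> show ?thesis using that[of i] by argo
qed

lemma P_function_complementarity_unique:
  assumes "P_function_on K G" and "x \<in> K" "y \<in> K"
    and x: "\<And>i. 0 \<le> x $ i" "\<And>i. 0 \<le> G x $ i" "\<And>i. x $ i * G x $ i = 0"
    and y: "\<And>i. 0 \<le> y $ i" "\<And>i. 0 \<le> G y $ i" "\<And>i. y $ i * G y $ i = 0"
  shows "x = y"
proof (rule ccontr)
  assume "x \<noteq> y"
  then obtain i where i: "(x $ i - y $ i) * (G x $ i - G y $ i) > 0"
    using P_function_onD assms(1-3) by blast
  have "(x $ i - y $ i) * (G x $ i - G y $ i) = - (x $ i * G y $ i) - y $ i * G x $ i"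
    using x(3)[of i] y(3)[of i] by argo
  moreover have "0 \<le> x $ i * G y $ i" "0 \<le> y $ i * G x $ i"
    using x y by simp_all
  ultimately show False using i by linarith
qed

lemma TCP_solution_iff:
  "TCP_solution m q A x \<longleftrightarrow>
     (\<forall>i. 0 \<le> x $ i) \<and> (\<forall>i. 0 \<le> (tensor_apply m A x + q) $ i) \<and>
     (\<forall>i. x $ i * (tensor_apply m A x + q) $ i = 0)"
proof -
  have "x \<bullet> w = 0 \<longleftrightarrow> (\<forall>i. x $ i * w $ i = 0)"
    if "\<forall>i. 0 \<le> x $ i" "\<forall>i. 0 \<le> w $ i" for w
    using that by (simp add: inner_vec_def sum_nonneg_eq_0_iff)
  then show ?thesis unfolding TCP_solution_def by blast
qed

section \<open>Existence for homogeneous maps\<close>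

text \<open>
  The fixed points of the clamped map \<open>x \<mapsto> clamp (x - G x)\<close> are the solutions of the variational
  inequality of \<open>G\<close> over the box.
\<close>

lemma box_complementarity:
  fixes G :: "real ^ 'n::finite \<Rightarrow> real ^ 'n"
  assumes cont: "continuous_on UNIV G" and r: "0 < r"
  obtains x where "\<And>i. 0 \<le> x $ i"
    and "\<And>i. x $ i < r \<Longrightarrow> 0 \<le> G x $ i"
    and "\<And>i. x $ i < r \<Longrightarrow> x $ i * G x $ i = 0"
    and "\<And>i. x $ i * G x $ i \<le> 0"
proof -
  let ?S = "cbox 0 (\<chi> i::'n. r)"
  let ?f = "\<lambda>x. \<chi> i. max 0 (min r (x $ i - G x $ i))"
  have "continuous_on ?S ?f"
    by (intro continuous_intros continuous_on_subset[OF cont]) auto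
  moreover have "?f \<in> ?S \<rightarrow> ?S" using r by (auto simp: mem_box_cart)
  moreover have "0 \<in> ?S" using r by (simp add: mem_box_cart)
  ultimately obtain x where x: "x \<in> ?S" "?f x = x"
    using brouwer[of ?S ?f] by auto
  have fix_i: "x $ i = max 0 (min r (x $ i - G x $ i))" for i
    using arg_cong[OF x(2), of "\<lambda>v. v $ i"] by simp
  have ge0: "0 \<le> x $ i" for i using fix_i[of i] by linarith
  have inner: "0 \<le> G x $ i \<and> (x $ i = 0 \<or> G x $ i = 0)" if "x $ i < r" for i
    using fix_i[of i] that by linarith
  have outer: "G x $ i \<le> 0" if "\<not> x $ i < r" for i
    using fix_i[of i] that r by linarith
  show ?thesis
  proof (rule that[of x])
    show "x $ i * G x $ i \<le> 0" for i
      using inner[of i] outer[of i] ge0[of i] by (cases "x $ i < r") (auto simp: mult_nonneg_nonpos)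
  qed (use ge0 inner in auto)
qed

text \<open>
  Summing the positive parts of the \<open>x\<^sub>i F\<^sub>i x\<close> gives a continuous substitute for their maximum.
  It is positive on the unit sphere, hence at least some \<open>c > 0\<close> there, and at least
  \<open>c \<parallel>x\<parallel>\<^sup>k\<^sup>+\<^sup>1\<close> everywhere by homogeneity.
\<close>

lemma homogeneous_a_priori_bound:
  fixes F :: "real ^ 'n::finite \<Rightarrow> real ^ 'n"
  assumes cont: "continuous_on UNIV F"
    and hom: "\<And>t x. F (t *\<^sub>R x) = t ^ k *\<^sub>R F x" and k: "k \<ge> 1"
    and pos: "\<And>x. x \<noteq> 0 \<Longrightarrow> \<exists>i. x $ i * F x $ i > 0"
  obtains r where "r > 0" and "\<And>x. (\<And>i. x $ i * (F x + q) $ i \<le> 0) \<Longrightarrow> norm x < r"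
proof -
  define h where "h x = (\<Sum>i\<in>UNIV. max 0 (x $ i * F x $ i))" for x
  have "continuous_on (sphere 0 1) h" unfolding h_def
    by (intro continuous_intros continuous_on_subset[OF cont]) auto
  moreover have "sphere (0 :: real ^ 'n) 1 \<noteq> {}" by simp
  ultimately obtain u where u: "u \<in> sphere 0 1" "\<And>v. v \<in> sphere 0 1 \<Longrightarrow> h u \<le> h v"
    using continuous_attains_inf[of "sphere 0 1" h] by auto
  define c where "c = h u"
  define N where "N = real CARD('n) * norm q"
  define r where "r = 1 + N / c"
  have c: "c > 0"
  proof -
    have "u \<noteq> 0" using u(1) by auto
    then obtain i where i: "u $ i * F u $ i > 0" using pos by blast
    show ?thesis unfolding c_def h_def
      by (rule sum_pos2[of _ i]) (use i in auto)
  qed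
  have N: "N \<ge> 0" by (simp add: N_def)
  have r: "r \<ge> 1" "N < c * r" using c N by (simp_all add: r_def field_simps)
  have "norm x < r" if x: "\<And>i. x $ i * (F x + q) $ i \<le> 0" for x
  proof (rule ccontr)
    assume "\<not> norm x < r"
    define s where "s = norm x"
    define v where "v = x /\<^sub>R s"
    have s: "r \<le> s" "1 \<le> s" using \<open>\<not> norm x < r\<close> r by (auto simp: s_def)
    have v: "v \<in> sphere 0 1" "x = s *\<^sub>R v" using s \<open>r \<ge> 1\<close>
      by (simp_all add: v_def flip: s_def)
    have "h x = (\<Sum>i\<in>UNIV. s ^ Suc k * max 0 (v $ i * F v $ i))"
      unfolding h_def
    proof (rule sum.cong)
      fix i
      have "x $ i * F x $ i = s ^ Suc k * (v $ i * F v $ i)"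
        unfolding v(2) hom by simp
      then show "max 0 (x $ i * F x $ i) = s ^ Suc k * max 0 (v $ i * F v $ i)"
        using s by (simp add: max_mult_distrib_left)
    qed simp
    then have "h x = s ^ Suc k * h v" by (simp add: h_def sum_distrib_left)
    then have lower: "s * (c * s ^ k) \<le> h x"
      using u(2)[OF v(1)] s by (simp add: c_def mult_left_mono)
    have "max 0 (x $ i * F x $ i) \<le> s * norm q" for i
    proof -
      have "x $ i * F x $ i \<le> - (x $ i * q $ i)" using x[of i] by (simp add: algebra_simps)
      also have "\<dots> \<le> \<bar>x $ i\<bar> * \<bar>q $ i\<bar>" by (simp flip: abs_mult)
      also have "\<dots> \<le> s * norm q"
        unfolding s_def by (intro mult_mono component_le_norm_cart) auto
      finally show ?thesis using s by simp
    qed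
    then have upper: "h x \<le> s * N"
      unfolding h_def N_def
      using sum_bounded_above[of UNIV "\<lambda>i. max 0 (x $ i * F x $ i)" "s * norm q"]
      by (simp add: mult_ac)
    have "s * (c * s ^ k) \<le> s * N" using lower upper by linarith
    then have "c * s ^ k \<le> N" using s by simp
    moreover have "s \<le> s ^ k" using s k by (simp add: self_le_power)
    then have "c * r \<le> c * s ^ k" using s c by simp
    ultimately show False using r by linarith
  qed
  then show ?thesis using that[of r] r by simp
qed

lemma homogeneous_complementarity_exists:
  fixes F :: "real ^ 'n::finite \<Rightarrow> real ^ 'n"
  assumes cont: "continuous_on UNIV F"
    and hom: "\<And>t x. F (t *\<^sub>R x) = t ^ k *\<^sub>R F x" and k: "k \<ge> 1"
    and pos: "\<And>x. x \<noteq> 0 \<Longrightarrow> \<exists>i. x $ i * F x $ i > 0"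
  obtains x where "\<And>i. 0 \<le> x $ i" "\<And>i. 0 \<le> (F x + q) $ i" "\<And>i. x $ i * (F x + q) $ i = 0"
proof -
  obtain r where r: "r > 0" "\<And>x. (\<And>i. x $ i * (F x + q) $ i \<le> 0) \<Longrightarrow> norm x < r"
    using homogeneous_a_priori_bound[OF cont hom k pos] by blast
  have "continuous_on UNIV (\<lambda>x. F x + q)" by (intro continuous_intros cont)
  then obtain x where x: "\<And>i. 0 \<le> x $ i" "\<And>i. x $ i < r \<Longrightarrow> 0 \<le> (F x + q) $ i"
    "\<And>i. x $ i < r \<Longrightarrow> x $ i * (F x + q) $ i = 0" "\<And>i. x $ i * (F x + q) $ i \<le> 0"
    using box_complementarity r(1) by blast
  have "x $ i < r" for i
    using r(2)[OF x(4)] component_le_norm_cart[of x i] by linarith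
  then show ?thesis using that x by blast
qed

section \<open>Tensor maps\<close>

lemma continuous_on_tensor_apply: "continuous_on S (tensor_apply m A)"
proof -
  have "continuous_on S (\<lambda>x. \<Prod>j\<leftarrow>js. x $ j)" for js :: "'a list"
    by (induction js) (auto intro!: continuous_intros)
  then show ?thesis unfolding tensor_apply_def by (intro continuous_intros)
qed

lemma tensor_apply_scaleR: "tensor_apply m A (t *\<^sub>R x) = t ^ (m - 1) *\<^sub>R tensor_apply m A x"
proof -
  have "(\<Prod>j\<leftarrow>js. (t *\<^sub>R x) $ j) = t ^ length js * (\<Prod>j\<leftarrow>js. x $ j)" for js
    by (induction js) auto
  then show ?thesis
    by (simp add: tensor_apply_def vec_eq_iff sum_distrib_left mult.left_commute)
qed

lemma strong_P_tensor_order_ge_2: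
  fixes A :: "'n::finite tensor"
  assumes "strong_P_tensor m A"
  shows "m \<ge> 2"
proof (rule ccontr)
  assume "\<not> m \<ge> 2"
  \<comment> \<open>The map is homogeneous of degree 0, so its values at a vector and at the origin agree.\<close>
  then have "tensor_apply m A 1 = tensor_apply m A 0"
    using tensor_apply_scaleR[of m A 0 1] by simp
  moreover have "P_function_on UNIV (tensor_apply m A)"
    using assms strong_P_tensor_iff[of m A 0] by simp
  ultimately show False
    using P_function_onD[of UNIV "tensor_apply m A" 1 0] by force
qed

theorem mainTheorem2:
  fixes m :: nat and A :: "'n::finite tensor"
  assumes "m \<ge> 1"
    and "strong_P_tensor m A"
  shows "GUS_property m A"
  unfolding GUS_property_def
proof (intro allI ex_ex1I)
  fix q
  let ?F = "tensor_apply m A"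
  have m: "m - 1 \<ge> 1" using strong_P_tensor_order_ge_2[OF assms(2)] by simp
  have F0: "?F 0 = 0" using tensor_apply_scaleR[of m A 0 0] m by (simp add: zero_power)
  have P: "P_function_on UNIV ?F" using assms(2) strong_P_tensor_iff[of m A 0] by simp
  have "\<exists>i. x $ i * ?F x $ i > 0" if "x \<noteq> 0" for x
    using P_function_onD[OF P _ _ that] F0 by auto
  then obtain x where "\<And>i. 0 \<le> x $ i" "\<And>i. 0 \<le> (?F x + q) $ i" "\<And>i. x $ i * (?F x + q) $ i = 0"
    using homogeneous_complementarity_exists[OF continuous_on_tensor_apply tensor_apply_scaleR m]
    by blast
  then show "\<exists>x. TCP_solution m q A x" by (auto simp: TCP_solution_iff)
next
  fix q x y
  assume "TCP_solution m q A x" "TCP_solution m q A y"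
  then show "x = y"
    using P_function_complementarity_unique[of UNIV "\<lambda>x. tensor_apply m A x + q" x y]
      assms(2) strong_P_tensor_iff[of m A q]
    by (simp add: TCP_solution_iff)
qed

end
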